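(* Let $G$ be a graph. Then $G$ has the strong parity property if and only if for every $T\subseteq V(G)$, \[ \sum_{x\in T}d_{G}(x)-2|T|-c(G-T)\geq -1, \] where $c(G-T)$ denotes the number of connected components of $G-T$.
   Context: Graphs are finite and simple. For a graph $G$, $V(G)$ is its vertex set, $d_G(x)$ is the degree of the vertex $x$ in $G$, and $\delta(G)$ is the minimum degree. For $T\subseteq V(G)$, $G-T$ is the subgraph of $G$ induced by $V(G)\setminus T$, and $c(G-T)$ is its number of connected components (so $c(G-T)=0$ when $T=V(G)$). A spanning subgraph of $G$ is a subgraph with vertex set $V(G)$. A graph $G$ has the strong parity property if for every subset $X\subseteq V(G)$ with $|X|$ even, $G$ has a spanning subgraph $F$ with $\delta(F)\geq 1$ (every vertex has degree at least one in $F$) such that $d_F(v)\equiv 1\pmod 2$ for all $v\in X$ and $d_F(y)\equiv 0\pmod 2$ for all $y\in V(G)\setminus X$. *)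

theory Defs
  imports "Graph_Theory.Digraph_Component"
begin

text \<open>
  Finite simple graphs are the symmetric digraphs of the locale predicate \<^const>\<open>graph\<close>: an
  undirected edge \<open>uv\<close> is the pair of arcs \<open>u \<rightarrow> v\<close>, \<open>v \<rightarrow> u\<close>. There are no loops and no parallel
  arcs, so the out-degree of a vertex is its undirected degree.
\<close>

abbreviation vertex_degree :: "('a,'b) pre_digraph \<Rightarrow> 'a \<Rightarrow> nat" where
  "vertex_degree G v \<equiv> out_degree G v"

definition delete_vertices :: "('a,'b) pre_digraph \<Rightarrow> 'a set \<Rightarrow> ('a,'b) pre_digraph" where
  "delete_vertices G T = G \<restriction> (verts G - T)"

text \<open>
  Components are the maximal connected subgraphs. \<^const>\<open>connected\<close> requires a nonempty vertex
  set, so the graph without vertices has no component.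
\<close>

definition components_of :: "('a,'b) pre_digraph \<Rightarrow> ('a,'b) pre_digraph set" where
  "components_of G = {H. pre_digraph.max_subgraph G connected H}"

lemma components_of_eq_sccs:
  assumes "sym_digraph G"
  shows "components_of G = pre_digraph.sccs G"
proof -
  interpret sym_digraph G by (rule assms)
  have strong: "strongly_connected (G \<restriction> verts H)" if "subgraph H G" "connected H" for H
  proof -
    have sub: "subgraph H (G \<restriction> verts H)" "induced_subgraph (G \<restriction> verts H) G"
      using that by (auto intro: subgraph_induce_subgraphI2 induced_induce)
    then have wf: "wf_digraph (G \<restriction> verts H)"
      by (auto intro: wf_digraphI_induced)
    have "spanning H (G \<restriction> verts H)"
      using sub by (simp add: spanning_def)
    with \<open>connected H\<close> wf have "connected (G \<restriction> verts H)"
      by (metis wf_digraph.connected_spanning_imp_connected)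
    moreover have "symmetric (G \<restriction> verts H)"
      using sym_arcs sub(2) by (rule induced_graph_imp_symmetric)
    ultimately show ?thesis
      using wf by (metis wf_digraph.symmetric_connected_imp_strongly_connected)
  qed
  have weak: "connected H" if "subgraph H G" "strongly_connected H" for H
  proof -
    interpret H: wf_digraph H using that(1) by (simp add: subgraph_def)
    show ?thesis
      using that(2) H.reachable_mk_symmetricI
      by (auto simp: connected_def strongly_connected_def mk_symmetric_def)
  qed
  have "max_subgraph connected H \<longleftrightarrow> max_subgraph strongly_connected H" for H
  proof
    assume H: "max_subgraph connected H"
    then have HG: "subgraph H G" "connected H"
      by (auto simp: max_subgraph_def)
    have sub: "subgraph H (G \<restriction> verts H)" "subgraph (G \<restriction> verts H) G"
      using HG(1) by (auto intro: subgraph_induce_subgraphI2 subgraph_induce_subgraphI)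
    then have "G \<restriction> verts H = H"
      using H weak[OF sub(2) strong[OF HG]] unfolding max_subgraph_def by blast
    with strong[OF HG] have "strongly_connected H" by simp
    with H weak show "max_subgraph strongly_connected H"
      unfolding max_subgraph_def by blast
  next
    assume H: "max_subgraph strongly_connected H"
    then have HG: "subgraph H G" "strongly_connected H"
      by (auto simp: max_subgraph_def)
    have "H' = H" if H': "subgraph H H'" "subgraph H' G" "connected H'" for H'
    proof -
      have sub: "subgraph H' (G \<restriction> verts H')" "subgraph (G \<restriction> verts H') G"
        using H'(2) by (auto intro: subgraph_induce_subgraphI2 subgraph_induce_subgraphI)
      then have "G \<restriction> verts H' = H"
        using H strong[OF H'(2,3)] subgraph_trans[OF H'(1) sub(1)]
        unfolding max_subgraph_def by blast
      with sub(1) H'(1) show ?thesis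
        by (auto simp: subgraph_def compatible_def intro: pre_digraph.equality)
    qed
    with HG weak show "max_subgraph connected H"
      unfolding max_subgraph_def by blast
  qed
  then show ?thesis
    by (simp add: components_of_def sccs_altdef2)
qed

definition num_components :: "('a,'b) pre_digraph \<Rightarrow> nat" where
  "num_components G = card (components_of G)"

text \<open>
  \<^const>\<open>spanning\<close> also admits subdigraphs containing only one of the two arcs of an edge; the
  conjunct \<open>graph F\<close> excludes these.
\<close>

definition strong_parity_property :: "('a,'b) pre_digraph \<Rightarrow> bool" where
  "strong_parity_property G \<longleftrightarrow>
     (\<forall>X. X \<subseteq> verts G \<and> even (card X) \<longrightarrow>
        (\<exists>F. graph F \<and> spanning F G \<and>
             (\<forall>v\<in>verts F. vertex_degree F v \<ge> 1) \<and>
             (\<forall>v\<in>X. odd (vertex_degree F v)) \<and>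
             (\<forall>y\<in>verts G - X. even (vertex_degree F y))))"

end

theory Submission
  imports Defs
begin

text \<open>
  A spanning subgraph \<open>F\<close> without isolated vertices and with odd degrees exactly on \<open>X\<close> has
  degree at least 1 on \<open>X\<close> and at least 2 elsewhere. Its complement \<open>H\<close> in \<open>G\<close> therefore
  satisfies \<open>d_H(v) \<le> b(v)\<close> and \<open>d_H(v) \<equiv> b(v) (mod 2)\<close>, where \<open>b = d - 1\<close> on \<open>X\<close> and
  \<open>b = d - 2\<close> off \<open>X\<close>; and the complement of any such \<open>H\<close> is such an \<open>F\<close>. By a generalisation of Tutte's
  theorem, \<^emph>\<open>parity_factor_exists\<close>, such an \<open>H\<close> exists if for every vertex set \<open>T\<close> at most
  \<open>b(T)\<close> components \<open>C\<close> of \<open>G - T\<close> have odd \<open>b(C)\<close>.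

  The sufficiency of the condition follows (\<^emph>\<open>realises_parity_if_deficiency\<close>), because
  \<open>b(T)\<close> is at least the sum of the \<open>d(x) - 2\<close> over \<open>T\<close>, and hence at least \<open>c(G - T) - 1\<close>.
  Since \<open>b(V)\<close> is even, \<open>b(T)\<close> has the same parity as the number of odd components, so that the
  loss of one does no harm. This is also why a condition that does not mention \<open>X\<close> can suffice.

  For the necessity (\<^emph>\<open>deficiency_if_realises_parity\<close>), given \<open>T\<close>, one chooses \<open>X\<close> outside
  \<open>T\<close>, with one vertex or none in each component of \<open>G - T\<close>, so that all components but at most
  one are odd in the above sense. By the handshaking lemma \<open>F\<close> misses an edge between \<open>T\<close> and each
  odd component, while at \<open>x \<in> T\<close> it misses at most \<open>d(x) - 2\<close> edges. The exceptional component
  is due to the evenness of \<open>card X\<close>, and explains the \<open>-1\<close>.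

  The argument is carried out for a symmetric relation \<open>E\<close> on a finite set; \<open>E `` {v}\<close> is the
  neighbourhood of \<open>v\<close>. The factor theorem is proved by induction over components, with
  Hall's theorem joining the odd components to a maximal tight set.
\<close>

section \<open>Components as minimal closed sets\<close>

text \<open>
  A component is encoded without paths, as a minimal nonempty set closed under adjacency. The effect
  of deleting vertices on components then becomes a matter of comparing closed sets.
\<close>

definition closed_in :: "('a \<times> 'a) set \<Rightarrow> 'a set \<Rightarrow> 'a set \<Rightarrow> bool" where
  "closed_in E A C \<longleftrightarrow> C \<subseteq> A \<and> (\<forall>x\<in>C. \<forall>y\<in>A. (x, y) \<in> E \<longrightarrow> y \<in> C)"

definition comps :: "('a \<times> 'a) set \<Rightarrow> 'a set \<Rightarrow> 'a set set" where
  "comps E A =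
     {C. C \<noteq> {} \<and> closed_in E A C \<and> (\<forall>D. D \<noteq> {} \<longrightarrow> closed_in E C D \<longrightarrow> D = C)}"

definition odd_comps :: "('a \<times> 'a) set \<Rightarrow> ('a \<Rightarrow> int) \<Rightarrow> 'a set \<Rightarrow> 'a set set" where
  "odd_comps E b A = {C \<in> comps E A. odd (sum b C)}"

lemma compsD:
  assumes "C \<in> comps E A"
  shows "C \<subseteq> A" "C \<noteq> {}" "\<And>x y. x \<in> C \<Longrightarrow> y \<in> A \<Longrightarrow> (x, y) \<in> E \<Longrightarrow> y \<in> C"
    "\<And>D. D \<noteq> {} \<Longrightarrow> closed_in E C D \<Longrightarrow> D = C"
  using assms by (auto simp: comps_def closed_in_def)

lemma comps_eqI:
  assumes C: "C \<in> comps E A" and D: "D \<in> comps E A" and x: "x \<in> C" "x \<in> D"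
  shows "C = D"
proof -
  have "closed_in E C (C \<inter> D)" "closed_in E D (C \<inter> D)"
    using compsD(1,3)[OF C] compsD(1,3)[OF D] by (auto simp: closed_in_def)
  moreover have "C \<inter> D \<noteq> {}" using x by blast
  ultimately show ?thesis
    using compsD(4)[OF C, of "C \<inter> D"] compsD(4)[OF D, of "C \<inter> D"] by blast
qed

lemma finite_comps: "finite A \<Longrightarrow> finite (comps E A)"
  by (rule finite_subset[of _ "Pow A"]) (auto dest: compsD(1))

lemma finite_odd_comps: "finite A \<Longrightarrow> finite (odd_comps E b A)"
  by (simp add: odd_comps_def finite_comps)

lemma comps_restrict: "comps (E \<inter> A \<times> A) A = comps E A"
proof -
  have *: "closed_in (E \<inter> A \<times> A) C D \<longleftrightarrow> closed_in E C D" if "C \<subseteq> A" for C D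
    using that unfolding closed_in_def by blast
  show ?thesis
    unfolding comps_def
  proof (rule Collect_cong)
    fix C
    show "(C \<noteq> {} \<and> closed_in (E \<inter> A \<times> A) A C \<and>
        (\<forall>D. D \<noteq> {} \<longrightarrow> closed_in (E \<inter> A \<times> A) C D \<longrightarrow> D = C)) \<longleftrightarrow>
      (C \<noteq> {} \<and> closed_in E A C \<and> (\<forall>D. D \<noteq> {} \<longrightarrow> closed_in E C D \<longrightarrow> D = C))"
    proof (cases "C \<subseteq> A")
      case True
      then show ?thesis by (simp add: *)
    qed (simp add: closed_in_def)
  qed
qed

text \<open>
  Minimality speaks only of adjacency inside the component, so a component has no other component
  than itself.
\<close>

lemma comps_component:
  assumes "C \<in> comps E A"
  shows "comps E C = {C}"
proof -
  have "C \<in> comps E C" using assms by (auto simp: comps_def closed_in_def)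
  then show ?thesis using compsD(4)[OF assms] by (auto simp: comps_def)
qed

lemma comps_closedI:
  assumes "C \<in> comps E A" "closed_in E B C"
  shows "C \<in> comps E B"
  using assms by (simp add: comps_def)

lemma comps_subset:
  assumes "C \<in> comps E A" "C \<subseteq> B" "B \<subseteq> A"
  shows "C \<in> comps E B"
  using assms(1)
proof (rule comps_closedI)
  show "closed_in E B C"
    using assms(2,3) compsD(3)[OF assms(1)] unfolding closed_in_def by blast
qed

text \<open>
  Putting vertices back that are not adjacent to a component leaves that component intact. This is
  what makes Hall's condition available later: components whose neighbours all lie in \<open>S\<close> are
  separated from the rest by \<open>S\<close> alone.
\<close>

lemma comps_mono_neighbours:
  assumes "C \<in> comps E A" "A \<subseteq> B"
    and "\<And>x y. x \<in> C \<Longrightarrow> y \<in> B \<Longrightarrow> (x, y) \<in> E \<Longrightarrow> y \<in> A"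
  shows "C \<in> comps E B"
  using assms(1)
proof (rule comps_closedI)
  show "closed_in E B C"
    using assms(2,3) compsD(1,3)[OF assms(1)] unfolding closed_in_def by blast
qed

context
  fixes E :: "('a \<times> 'a) set"
  assumes sym_E: "sym E"
begin

lemma closed_in_complement: "closed_in E A C \<Longrightarrow> closed_in E A (A - C)"
  using sym_E unfolding closed_in_def sym_def by blast

text \<open>
  A smallest closed set around a vertex is a component: of two complementary closed parts of it, one
  contains the vertex and would be smaller. Symmetry is what makes complements closed.
\<close>

lemma Union_comps:
  assumes "finite A"
  shows "\<Union>(comps E A) = A"
proof
  show "\<Union>(comps E A) \<subseteq> A" by (auto dest: compsD(1))
  show "A \<subseteq> \<Union>(comps E A)"
  proof
    fix x assume "x \<in> A"
    let ?P = "\<lambda>C. x \<in> C \<and> closed_in E A C"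
    have "?P A" using \<open>x \<in> A\<close> by (simp add: closed_in_def)
    then obtain C where C: "?P C" and least: "\<And>D. ?P D \<Longrightarrow> card C \<le> card D"
      using ex_has_least_nat[of ?P A card] by blast
    have fin: "finite C" using C assms by (auto simp: closed_in_def intro: finite_subset)
    have "D = C" if D: "D \<noteq> {}" "closed_in E C D" for D
    proof (rule ccontr)
      assume "D \<noteq> C"
      with D fin have less: "card D < card C" "card (C - D) < card C"
        by (auto simp: closed_in_def intro!: psubset_card_mono)
      have "closed_in E A D" "closed_in E A (C - D)"
        using C D(2) closed_in_complement[OF D(2)] unfolding closed_in_def by blast+
      then show False using least[of D] least[of "C - D"] less C by auto
    qed
    with C have "C \<in> comps E A" by (auto simp: comps_def)
    with C show "x \<in> \<Union>(comps E A)" by blast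
  qed
qed

text \<open>
  Summing \<open>b\<close> component by component modulo 2, only the odd components count. All parity gains in
  the later arguments, by which an inequality that may fail by one is saved or one that is strict
  improves to a gap of two, come from this lemma.
\<close>

lemma even_sum_minus_odd_comps:
  assumes "finite A"
  shows "even (sum b A - int (card (odd_comps E b A)))"
proof -
  have "sum b A = sum b (\<Union>(comps E A))" by (simp add: Union_comps[OF assms])
  also have "\<dots> = (\<Sum>C\<in>comps E A. sum b C)"
    using assms by (subst sum.Union_disjoint)
      (auto dest: comps_eqI compsD(1) intro: finite_subset)
  finally have "even (sum b A) \<longleftrightarrow> even (card (odd_comps E b A))"
    using even_sum_iff[OF finite_comps[OF assms], of "sum b"] by (simp add: odd_comps_def)
  then show ?thesis by simp
qed

text \<open>
  Deleting a part \<open>S\<close> of a component \<open>C\<close> replaces \<open>C\<close> by the components of \<open>C - S\<close> and leaves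
  the other components alone. Thus conditions on the whole graph restrict to conditions on \<open>C\<close>.
\<close>

lemma comps_Diff_within:
  assumes C: "C \<in> comps E B" and S: "S \<subseteq> C"
  shows "comps E (B - S) = (comps E B - {C}) \<union> comps E (C - S)"
proof (intro set_eqI iffI)
  note C' = compsD[OF C]
  have no_edge: "y \<notin> C" if "D \<inter> C = {}" "D \<subseteq> B" "x \<in> D" "(x, y) \<in> E" for D x y
    using C'(3)[of y x] that symD[OF sym_E] by blast
  fix D assume D: "D \<in> comps E (B - S)"
  show "D \<in> (comps E B - {C}) \<union> comps E (C - S)"
  proof (cases "D \<inter> C = {}")
    case True
    with D have "D \<in> comps E B"
      using no_edge[OF True] S compsD(1)[OF D]
      by (intro comps_mono_neighbours[OF D]) blast+
    with True compsD(2)[OF D] show ?thesis by auto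
  next
    case False
    have "closed_in E D (D \<inter> C)"
      using C'(3) compsD(1)[OF D] unfolding closed_in_def by blast
    then have "D \<inter> C = D" using False by (intro compsD(4)[OF D])
    with compsD(1)[OF D] have "D \<subseteq> C - S" by auto
    then have "D \<in> comps E (C - S)"

      using C'(1) by (intro comps_subset[OF D]) auto
    then show ?thesis by blast
  qed
next
  note C' = compsD[OF C]
  fix D assume "D \<in> (comps E B - {C}) \<union> comps E (C - S)"
  then show "D \<in> comps E (B - S)"
  proof
    assume D: "D \<in> comps E B - {C}"
    then have "D \<inter> C = {}" using comps_eqI[OF C, of D] by blast
    moreover have "D \<subseteq> B" using D compsD(1)[of D E B] by blast
    ultimately have "D \<subseteq> B - S" using S by blast
    then show ?thesis using D comps_subset[of D E B "B - S"] by blast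
  next
    assume D: "D \<in> comps E (C - S)"
    show ?thesis
      using C'(1,3) compsD(1)[OF D] by (intro comps_mono_neighbours[OF D]) blast+
  qed
qed

lemma card_odd_comps_Diff_within:
  assumes fin: "finite B" and C: "C \<in> comps E B" and S: "S \<subseteq> C"
  shows "int (card (odd_comps E b (B - S))) =
    int (card (odd_comps E b B)) - of_bool (odd (sum b C)) + int (card (odd_comps E b (C - S)))"
proof -
  have finC: "finite (C - S)" using finite_subset[OF compsD(1)[OF C] fin] by simp
  have "odd_comps E b (B - S) = (odd_comps E b B - {C}) \<union> odd_comps E b (C - S)"
    using comps_Diff_within[OF C S] by (auto simp: odd_comps_def)
  moreover have "(odd_comps E b B - {C}) \<inter> odd_comps E b (C - S) = {}"
  proof -
    have "D = C" if "D \<in> comps E B" "D \<in> comps E (C - S)" for D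
      using comps_eqI[OF that(1) C] compsD(1,2)[OF that(2)] by blast
    then show ?thesis by (auto simp: odd_comps_def)
  qed
  ultimately have "card (odd_comps E b (B - S)) =
      card (odd_comps E b B - {C}) + card (odd_comps E b (C - S))"
    using fin finC by (simp add: card_Un_disjoint finite_odd_comps)
  moreover have "int (card (odd_comps E b B - {C})) =
      int (card (odd_comps E b B)) - of_bool (odd (sum b C))"
  proof (cases "odd (sum b C)")
    case True
    then have "C \<in> odd_comps E b B" using C by (simp add: odd_comps_def)
    then have "card (odd_comps E b B) = Suc (card (odd_comps E b B - {C}))"
      using finite_odd_comps[OF fin] by (metis card.remove)
    with True show ?thesis by simp
  next
    case False
    then have "odd_comps E b B - {C} = odd_comps E b B" by (auto simp: odd_comps_def)
    with False show ?thesis by simp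
  qed
  ultimately show ?thesis by simp
qed

text \<open>
  A single vertex lies in one component at most, so no other component can change its parity.
\<close>

lemma card_odd_comps_change_one:
  assumes fin: "finite A" and eq: "\<And>x. x \<noteq> u \<Longrightarrow> b' x = b x"
  shows "card (odd_comps E b' A) \<le> card (odd_comps E b A) + 1"
proof -
  let ?U = "{D \<in> comps E A. u \<in> D}"
  have "odd_comps E b' A \<subseteq> odd_comps E b A \<union> ?U"
  proof
    fix D assume D: "D \<in> odd_comps E b' A"
    have "sum b' D = sum b D" if "u \<notin> D" using that eq by (metis sum.cong)
    with D show "D \<in> odd_comps E b A \<union> ?U" by (cases "u \<in> D") (auto simp: odd_comps_def)
  qed
  then have "card (odd_comps E b' A) \<le> card (odd_comps E b A \<union> ?U)"
    using fin by (intro card_mono) (auto simp: finite_odd_comps finite_comps)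
  also have "\<dots> \<le> card (odd_comps E b A) + card ?U" by (rule card_Un_le)
  also have "card ?U \<le> 1"
    using fin comps_eqI[of _ E A] by (auto simp: card_le_Suc0_iff_eq finite_comps)
  finally show ?thesis by simp
qed

end

section \<open>Matching into points with capacities\<close>

text \<open>
  Hall's marriage theorem where a point \<open>t\<close> may serve \<open>c t\<close> partners. The induction is that of
  Halmos and Vaughan: if every proper nonempty subfamily has a spare place, any first choice leaves
  Hall's condition intact; otherwise a subfamily that fills its places exactly is matched on its own,
  and the rest of the family satisfies Hall's condition away from those places.
\<close>

lemma capacitated_hall:
  fixes N :: "'i \<Rightarrow> 'a set" and c :: "'a \<Rightarrow> nat"
  assumes "finite I" "\<And>i. i \<in> I \<Longrightarrow> finite (N i)"
    and "\<And>J. J \<subseteq> I \<Longrightarrow> card J \<le> sum c (\<Union>(N ` J))"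
  shows "\<exists>f. (\<forall>i\<in>I. f i \<in> N i) \<and> (\<forall>t. card {i \<in> I. f i = t} \<le> c t)"
  using assms
proof (induction "card I" arbitrary: I N c rule: less_induct)
  case less
  note fin = less.prems(1,2) and hall = less.prems(3)
  have finU: "finite (\<Union>(N ` J))" if "J \<subseteq> I" for J
    using fin that by (auto intro: finite_subset)
  consider (empty) "I = {}"
    | (slack) "I \<noteq> {}" "\<And>J. J \<subset> I \<Longrightarrow> J \<noteq> {} \<Longrightarrow> card J < sum c (\<Union>(N ` J))"
    | (tight) J where "J \<subset> I" "J \<noteq> {}" "sum c (\<Union>(N ` J)) \<le> card J"
    by (meson not_less)
  then show ?case
  proof cases
    case empty
    then show ?thesis by simp
  next
    case slack
    then obtain i where i: "i \<in> I" by blast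
    have "sum c (N i) \<noteq> 0" using hall[of "{i}"] i by auto
    then obtain t where t: "t \<in> N i" "c t > 0" by (metis neq0_conv sum.neutral)
    define c' where "c' = c(t := c t - 1)"
    \<comment> \<open>Using up a place at \<open>t\<close> costs any set at most one; the strict inequality of this case pays
      for it.\<close>
    have c_c': "sum c S \<le> sum c' S + 1" if "finite S" for S
    proof -
      have "sum c S = (\<Sum>x\<in>S. c' x + (if x = t then 1 else 0))"
        using t by (intro sum.cong) (auto simp: c'_def)
      also have "\<dots> \<le> sum c' S + 1" using that by (simp add: sum.distrib)
      finally show ?thesis .
    qed
    have "\<exists>f. (\<forall>j\<in>I - {i}. f j \<in> N j) \<and> (\<forall>s. card {j \<in> I - {i}. f j = s} \<le> c' s)"
    proof (rule less.hyps)
      show "card (I - {i}) < card I" using i fin by (intro psubset_card_mono) auto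
      fix J assume J: "J \<subseteq> I - {i}"
      show "card J \<le> sum c' (\<Union>(N ` J))"
      proof (cases "J = {}")
        case False
        then have "card J < sum c (\<Union>(N ` J))" using J i by (intro slack(2)) auto
        also have "\<dots> \<le> sum c' (\<Union>(N ` J)) + 1" using J by (intro c_c' finU) auto
        finally show ?thesis by simp
      qed simp
    qed (use fin in auto)
    then obtain f where f: "\<forall>j\<in>I - {i}. f j \<in> N j"
        "\<And>s. card {j \<in> I - {i}. f j = s} \<le> c' s" by blast
    have "card {j \<in> I. (f(i := t)) j = s} \<le> c s" for s
    proof (cases "s = t")
      case True
      have "{j \<in> I. (f(i := t)) j = s} = insert i {j \<in> I - {i}. f j = t}"
        using i True by auto
      then show ?thesis using f(2)[of t] t True fin by (simp add: c'_def)
    next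
      case False
      then have "{j \<in> I. (f(i := t)) j = s} = {j \<in> I - {i}. f j = s}" by auto
      then show ?thesis using f(2)[of s] False by (simp add: c'_def)
    qed
    moreover have "\<forall>j\<in>I. (f(i := t)) j \<in> N j" using f t by auto
    ultimately show ?thesis by blast
  next
    case tight
    let ?M = "\<Union>(N ` J)"
    have finJ: "finite J" using tight fin by (auto intro: finite_subset)
    have "\<exists>f. (\<forall>i\<in>J. f i \<in> N i) \<and> (\<forall>t. card {i \<in> J. f i = t} \<le> c t)"
    proof (rule less.hyps)
      show "card J < card I" using tight fin by (simp add: psubset_card_mono)
      show "card K \<le> sum c (\<Union>(N ` K))" if "K \<subseteq> J" for K
        using that tight by (intro hall) auto
    qed (use tight fin finJ in auto)
    then obtain f where f: "\<forall>i\<in>J. f i \<in> N i" "\<And>t. card {i \<in> J. f i = t} \<le> c t" by blast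
    have "\<exists>g. (\<forall>i\<in>I - J. g i \<in> N i - ?M) \<and> (\<forall>t. card {i \<in> I - J. g i = t} \<le> c t)"
    proof (rule less.hyps)
      show "card (I - J) < card I" using tight fin by (intro psubset_card_mono) auto
      fix K assume K: "K \<subseteq> I - J"
      have "card K + card J = card (K \<union> J)"
        using K finJ fin by (subst card_Un_disjoint) (auto intro: finite_subset)
      also have "\<dots> \<le> sum c (\<Union>(N ` (K \<union> J)))" using K tight by (intro hall) auto
      also have "\<Union>(N ` (K \<union> J)) = (\<Union>i\<in>K. N i - ?M) \<union> ?M" by auto
      also have "sum c \<dots> = sum c (\<Union>i\<in>K. N i - ?M) + sum c ?M"
      proof (rule sum.union_disjoint)
        show "finite (\<Union>i\<in>K. N i - ?M)"
          using K by (intro finite_subset[OF _ finU[of K]]) auto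
        show "finite ?M" using tight by (intro finU) auto
      qed auto
      also have "sum c ?M \<le> card J" by (rule tight)
      finally show "card K \<le> sum c (\<Union>i\<in>K. N i - ?M)" by simp
    qed (use fin in auto)
    then obtain g where g: "\<forall>i\<in>I - J. g i \<in> N i - ?M"
        "\<And>t. card {i \<in> I - J. g i = t} \<le> c t" by blast
    define h where "h = (\<lambda>i. if i \<in> J then f i else g i)"
    have "card {i \<in> I. h i = t} \<le> c t" for t
    proof (cases "t \<in> ?M")
      case True
      then have "g i \<noteq> t" if "i \<in> I - J" for i using g(1) that by (metis DiffD2)
      then have "{i \<in> I. h i = t} = {i \<in> J. f i = t}" using tight(1) by (auto simp: h_def)
      then show ?thesis using f(2) by simp
    next
      case False
      then have "f i \<noteq> t" if "i \<in> J" for i using f(1) that by (metis UN_I)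
      then have "{i \<in> I. h i = t} = {i \<in> I - J. g i = t}" by (auto simp: h_def)
      then show ?thesis using g(2) by simp
    qed
    moreover have "\<forall>i\<in>I. h i \<in> N i" using f g by (auto simp: h_def)
    ultimately show ?thesis by blast
  qed
qed

section \<open>Factors with degree bounds and prescribed parities\<close>

definition parity_factor :: "('a \<times> 'a) set \<Rightarrow> ('a \<Rightarrow> int) \<Rightarrow> 'a set \<Rightarrow> ('a \<times> 'a) set \<Rightarrow> bool" where
  "parity_factor E b A H \<longleftrightarrow> H \<subseteq> E \<inter> A \<times> A \<and> sym H \<and>
     (\<forall>v\<in>A. int (card (H `` {v})) \<le> b v \<and> even (b v - int (card (H `` {v}))))"

text \<open>
  How factors of the components of \<open>A - T\<close> combine when \<open>T\<close> is tight, that is, when the odd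
  components number exactly \<open>b(T)\<close>. Each odd component \<open>C\<close> sends a single edge, from its vertex
  \<open>h C\<close>, to \<open>f C\<close> in \<open>T\<close>; its inner factor has to leave room for that edge, hence the
  bound lowered by one at \<open>h C\<close>. The vertices of \<open>T\<close> get no other edges, so the number of odd
  components assigned to a vertex of \<open>T\<close> is its degree.
\<close>

lemma parity_factor_glue:
  fixes b :: "'a \<Rightarrow> int" and h :: "'a set \<Rightarrow> 'a" and f :: "'a set \<Rightarrow> 'a"
    and F :: "'a set \<Rightarrow> ('a \<times> 'a) set"
    and A T :: "'a set" and E :: "('a \<times> 'a) set"
  defines "Odd \<equiv> odd_comps E b (A - T)"
  assumes sym_E: "sym E" and finA: "finite A" and T: "T \<subseteq> A"
    and h: "\<And>C. C \<in> Odd \<Longrightarrow> h C \<in> C"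
    and f: "\<And>C. C \<in> Odd \<Longrightarrow> f C \<in> T"
    and edge: "\<And>C. C \<in> Odd \<Longrightarrow> (f C, h C) \<in> E"
    and cap: "\<And>t. t \<in> T \<Longrightarrow> int (card {C \<in> Odd. f C = t}) = b t"
    and F_odd: "\<And>C. C \<in> Odd \<Longrightarrow> parity_factor E (b(h C := b (h C) - 1)) C (F C)"
    and F_even: "\<And>C. C \<in> comps E (A - T) \<Longrightarrow> C \<notin> Odd \<Longrightarrow> parity_factor E b C (F C)"
  shows "\<exists>H. parity_factor E b A H"
proof -
  let ?K = "comps E (A - T)"
  \<comment> \<open>The linking edges, each directed from \<open>T\<close> to its component.\<close>
  define L where "L = (\<lambda>C. (f C, h C)) ` Odd"
  define H where "H = (\<Union>C\<in>?K. F C) \<union> L \<union> L\<inverse>"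
  have OK: "Odd \<subseteq> ?K" by (auto simp: Odd_def odd_comps_def)
  have finAT: "finite (A - T)" using finA by simp
  have K_sub: "C \<subseteq> A" "C \<inter> T = {}" "finite C" if "C \<in> ?K" for C
    using compsD(1)[OF that] finite_subset[OF _ finAT] by auto
  have F: "F C \<subseteq> E \<inter> C \<times> C" "sym (F C)" if "C \<in> ?K" for C
    using F_odd[of C] F_even[OF that] by (auto simp: parity_factor_def)
  have K_eq: "C = D" if "C \<in> ?K" "D \<in> ?K" "v \<in> C" "v \<in> D" for C D v
    using comps_eqI that by metis
  have L_E: "L \<subseteq> E" using edge by (auto simp: L_def)
  have ends: "f C \<in> A" "h C \<in> A" if "C \<in> Odd" for C
    using f[OF that] h[OF that] T K_sub(1)[of C] OK that by auto
  have "H \<subseteq> E"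
  proof -
    have "F C \<subseteq> E" if "C \<in> ?K" for C using F(1)[OF that] by simp
    then have "(\<Union>C\<in>?K. F C) \<subseteq> E" by (rule UN_least)
    moreover have "L\<inverse> \<subseteq> E" using L_E symD[OF sym_E] by auto
    ultimately show ?thesis using L_E by (simp add: H_def)
  qed
  moreover have "H \<subseteq> A \<times> A"
  proof -
    have "F C \<subseteq> A \<times> A" if "C \<in> ?K" for C using F(1)[OF that] K_sub(1)[OF that] by auto
    then have "(\<Union>C\<in>?K. F C) \<subseteq> A \<times> A" by (rule UN_least)
    moreover have "L \<subseteq> A \<times> A" using ends by (auto simp: L_def)
    ultimately show ?thesis by (auto simp: H_def)
  qed
  moreover have "sym H"
  proof -
    have "sym (\<Union>C\<in>?K. F C)" using F(2) by (auto simp: sym_def)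
    then show ?thesis by (auto simp: H_def sym_def)
  qed
  moreover have "int (card (H `` {v})) \<le> b v \<and> even (b v - int (card (H `` {v})))"
    if "v \<in> A" for v
  proof (cases "v \<in> T")
    case True
    have "(v, w) \<notin> F C" if "C \<in> ?K" for C w
      using F(1)[OF that] K_sub(2)[OF that] True by blast
    moreover have "h C \<noteq> v" if "C \<in> Odd" for C
      using h[OF that] K_sub(2)[of C] OK that True by blast
    ultimately have "H `` {v} = h ` {C \<in> Odd. f C = v}"
      by (auto simp: H_def L_def)
    moreover have "inj_on h {C \<in> Odd. f C = v}"
    proof (rule inj_onI)
      fix C D assume "C \<in> {C \<in> Odd. f C = v}" "D \<in> {C \<in> Odd. f C = v}" "h C = h D"
      then show "C = D" using K_eq[of C D "h C"] h[of C] h[of D] OK by auto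
    qed
    ultimately have "int (card (H `` {v})) = b v"
      using cap[OF True] by (simp add: card_image)
    then show ?thesis by simp
  next
    case False
    with that have "v \<in> \<Union>?K" by (simp add: Union_comps[OF sym_E finAT])
    then obtain C where C: "C \<in> ?K" "v \<in> C" by (rule UnionE)
    have other: "(v, w) \<notin> F D" if "D \<in> ?K" "D \<noteq> C" for D w
      using F(1)[OF that(1)] K_eq[OF C(1) that(1) C(2)] that(2) by blast
    have hv: "D = C" if "D \<in> Odd" "h D = v" for D
      using K_eq[OF _ C(1) _ C(2), of D] that h[OF that(1)] OK by blast
    have L_v: "(v, w) \<notin> L" for w
    proof
      assume "(v, w) \<in> L"
      then obtain D where "D \<in> Odd" "f D = v" by (auto simp: L_def)
      then show False using f[of D] False by simp
    qed
    have H_v: "(v, w) \<in> H \<longleftrightarrow> (v, w) \<in> F C \<or> (w, v) \<in> L" for w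
    proof
      assume "(v, w) \<in> H"
      then show "(v, w) \<in> F C \<or> (w, v) \<in> L" using other L_v by (auto simp: H_def)
    qed (use C(1) in \<open>auto simp: H_def\<close>)
    have fin: "finite (F C `` {v})"
      using F(1)[OF C(1)] K_sub(3)[OF C(1)] by (auto intro: finite_subset[of _ C])
    have F_im: "w \<in> C" if "(v, w) \<in> F C" for w using F(1)[OF C(1)] that by blast
    show ?thesis
    proof (cases "C \<in> Odd \<and> h C = v")
      case True
      have L_w: "(w, v) \<in> L \<longleftrightarrow> w = f C" for w
      proof
        assume "(w, v) \<in> L"
        then obtain D where "D \<in> Odd" "h D = v" "w = f D" by (auto simp: L_def)
        then show "w = f C" using hv by blast
      qed (use True in \<open>auto simp: L_def\<close>)
      have "H `` {v} = insert (f C) (F C `` {v})"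
        by (rule set_eqI) (simp add: Image_singleton_iff H_v L_w disj_commute)
      moreover have "f C \<notin> F C `` {v}"
        using F_im f[of C] True K_sub(2)[OF C(1)] by blast
      ultimately have "card (H `` {v}) = Suc (card (F C `` {v}))" using fin by simp
      moreover have "int (card (F C `` {v})) \<le> b v - 1"
        "even (b v - 1 - int (card (F C `` {v})))"
        using F_odd[of C] True C(2) by (auto simp: parity_factor_def)
      ultimately show ?thesis by auto
    next
      case nh: False
      have L_w: "(w, v) \<notin> L" for w
      proof
        assume "(w, v) \<in> L"
        then obtain D where "D \<in> Odd" "h D = v" by (auto simp: L_def)
        then show False using hv nh by blast
      qed
      have "H `` {v} = F C `` {v}"
        by (rule set_eqI) (simp add: Image_singleton_iff H_v L_w)
      moreover have "int (card (F C `` {v})) \<le> b v" "even (b v - int (card (F C `` {v})))"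
        using F_odd[of C] F_even[OF C(1)] nh C(2)
        by (cases "C \<in> Odd"; auto simp: parity_factor_def)+
      ultimately show ?thesis by simp
    qed
  qed
  ultimately show ?thesis unfolding parity_factor_def by blast
qed

lemma odd_comps_cong:
  assumes "\<And>x. x \<in> A \<Longrightarrow> even (b x - b' x)"
  shows "odd_comps E b A = odd_comps E b' A"
proof -
  have "odd (sum b C) \<longleftrightarrow> odd (sum b' C)" if "C \<in> comps E A" for C
  proof -
    have "even (\<Sum>x\<in>C. b x - b' x)" using assms compsD(1)[OF that] by (intro dvd_sum) auto
    then show ?thesis by (simp add: sum_subtractf)
  qed
  then show ?thesis by (auto simp: odd_comps_def)
qed

lemma sum_decrement:
  fixes b :: "'a \<Rightarrow> int"
  assumes "finite S"
  shows "sum (b(u := b u - k)) S = sum b S - (if u \<in> S then k else 0)"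
proof -
  have "sum (b(u := b u - k)) S = (\<Sum>x\<in>S. b x - (if x = u then k else 0))"
    by (intro sum.cong) auto
  then show ?thesis using assms by (simp add: sum_subtractf)
qed

text \<open>
  A Tutte-type theorem: for \<open>b\<close> constantly 1 it says that a graph has a perfect matching if no set
  \<open>S\<close> leaves more than \<open>card S\<close> odd components. For odd positive \<open>b\<close> it is the criterion of
  Amahashi and of Cui and Kano for \<open>(1,b)\<close>-odd factors.

  The proof takes a maximal tight set \<open>T\<close>. If \<open>T\<close> is empty, then by parity every nonempty set has
  a slack of two, so that \<open>b\<close> can be lowered by two at any vertex. Otherwise all components of
  \<open>A - T\<close> are smaller. An even component inherits the condition. An odd one, by maximality of
  \<open>T\<close>, inherits it with a slack of one for nonempty sets, and thus keeps it after \<open>b\<close> is lowered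
  by one at an arbitrary vertex. Hall's theorem assigns the odd components to the vertices of \<open>T\<close>;
  as \<open>T\<close> is tight, all places are filled, and the factors of the components can be glued.
\<close>

theorem parity_factor_exists:
  fixes b :: "'a \<Rightarrow> int"
  assumes sym_E: "sym E" and "finite A"
    and "\<And>S. S \<subseteq> A \<Longrightarrow> int (card (odd_comps E b (A - S))) \<le> sum b S"
  shows "\<exists>H. parity_factor E b A H"
  using assms(2-)
proof (induction "nat (sum b A) + card A" arbitrary: A b rule: less_induct)
  case less
  note fin = less.prems(1) and cond = less.prems(2)
  define q where "q = (\<lambda>S. int (card (odd_comps E b (A - S))))"
  have q_le: "q S \<le> sum b S" if "S \<subseteq> A" for S using cond[OF that] by (simp add: q_def)
  have b_nonneg: "0 \<le> b v" if "v \<in> A" for v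
    using q_le[of "{v}"] that by (simp add: q_def)
  have even_A: "even (sum b A)"
    using even_sum_minus_odd_comps[OF sym_E fin, of b] q_le[of "{}"] by (simp add: q_def)
  have parity: "even (sum b S - q S)" if "S \<subseteq> A" for S
  proof -
    have "sum b A = sum b (A - S) + sum b S" using sum.subset_diff[OF that fin] .
    then have "sum b S - q S = sum b A - (sum b (A - S) - q S) - 2 * q S" by simp
    moreover have "even (sum b (A - S) - q S)"
      using even_sum_minus_odd_comps[OF sym_E, of "A - S" b] fin by (simp add: q_def)
    ultimately show ?thesis using even_A by simp
  qed
  have slack: "q S \<le> sum b S - 2" if "S \<subseteq> A" "q S \<noteq> sum b S" for S
    using parity[OF that(1)] q_le[OF that(1)] that(2) by presburger
  \<comment> \<open>A set that is not tight has, by parity, a slack of two.\<close>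
  define tight where "tight = {S. S \<subseteq> A \<and> q S = sum b S}"
  have "finite tight" using fin by (auto simp: tight_def)
  moreover have "{} \<in> tight" using q_le[of "{}"] by (simp add: tight_def q_def)
  ultimately obtain T where T: "T \<in> tight" and maximal: "\<And>S. S \<in> tight \<Longrightarrow> T \<subseteq> S \<Longrightarrow> S = T"
    using finite_has_maximal[of tight] by blast
  have TA: "T \<subseteq> A" and qT: "q T = sum b T" using T by (auto simp: tight_def)
  have above: "q S \<le> sum b S - 2" if "S \<subseteq> A" "T \<subset> S" for S
    using slack[OF that(1)] maximal[of S] that by (auto simp: tight_def)
  consider "A = {}" | (empty) "T = {}" "A \<noteq> {}" | (nonempty) "T \<noteq> {}" by blast
  then show ?case
  proof cases
    case 1
    then show ?thesis by (auto simp: parity_factor_def sym_def)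
  next
    case empty
    then obtain v where v: "v \<in> A" by blast
    define b' where "b' = b(v := b v - 2)"
    have sum_b': "sum b' S = sum b S - (if v \<in> S then 2 else 0)" if "S \<subseteq> A" for S
      unfolding b'_def using finite_subset[OF that fin] by (rule sum_decrement)
    have odd_b': "odd_comps E b' S = odd_comps E b S" for S
      by (rule odd_comps_cong) (simp add: b'_def)
    have "\<exists>H. parity_factor E b' A H"
    proof (rule less.hyps)
      have "0 \<le> q A" by (simp add: q_def)
      moreover have "q A \<le> sum b A - 2" using empty by (intro above) (auto simp: psubset_eq)
      ultimately have "2 \<le> sum b A" by simp
      then show "nat (sum b' A) + card A < nat (sum b A) + card A"
        using sum_b'[of A] v by simp
    next
      fix S assume S: "S \<subseteq> A"
      show "int (card (odd_comps E b' (A - S))) \<le> sum b' S"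
      proof (cases "S = {}")
        case True
        then show ?thesis using q_le[of "{}"] by (simp add: odd_b' q_def)
      next
        case False
        then have "q S \<le> sum b S - 2" using S empty by (intro above) (auto simp: psubset_eq)
        then show ?thesis using sum_b'[OF S] by (simp add: odd_b' q_def split: if_splits)
      qed
    qed (rule fin)
    then obtain H where "parity_factor E b' A H" by blast
    then have "parity_factor E b A H"
      unfolding parity_factor_def b'_def by (auto split: if_splits)
    then show ?thesis by blast
  next
    case nonempty
    let ?K = "comps E (A - T)" and ?O = "odd_comps E b (A - T)"
    have finAT: "finite (A - T)" using fin by simp
    have K_sub: "C \<subseteq> A" "C \<inter> T = {}" "C \<noteq> {}" "finite C" if "C \<in> ?K" for C
      using compsD(1,2)[OF that] finite_subset[OF _ finAT] by auto
    have q_C: "q T - of_bool (odd (sum b C)) + int (card (odd_comps E b (C - S))) = q (T \<union> S)"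
      and sum_TS: "sum b (T \<union> S) = sum b T + sum b S"
      if "C \<in> ?K" "S \<subseteq> C" for C S
    proof -
      have "A - (T \<union> S) = A - T - S" by blast
      then show "q T - of_bool (odd (sum b C)) + int (card (odd_comps E b (C - S))) = q (T \<union> S)"
        using card_odd_comps_Diff_within[OF sym_E finAT that, of b] by (simp add: q_def)
      show "sum b (T \<union> S) = sum b T + sum b S"
        using that K_sub[OF that(1)] TA fin
        by (intro sum.union_disjoint) (auto intro: finite_subset)
    qed
    have smaller: "sum b C \<le> sum b A" "card C < card A" if "C \<in> ?K" for C
    proof -
      show "sum b C \<le> sum b A"
        using K_sub(1)[OF that] fin b_nonneg by (intro sum_mono2) auto
      show "card C < card A"
        using K_sub(1,2)[OF that] nonempty TA fin by (intro psubset_card_mono) auto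
    qed
    have even_factor: "\<exists>H. parity_factor E b C H" if C: "C \<in> ?K" "C \<notin> ?O" for C
    proof (rule less.hyps)
      show "nat (sum b C) + card C < nat (sum b A) + card A"
        using smaller[OF C(1)] by linarith
      fix S assume S: "S \<subseteq> C"
      have "q (T \<union> S) \<le> sum b (T \<union> S)" using S TA K_sub(1)[OF C(1)] by (intro q_le) auto
      then show "int (card (odd_comps E b (C - S))) \<le> sum b S"
        using q_C[OF C(1) S] sum_TS[OF C(1) S] C qT by (auto simp: odd_comps_def)
    qed (rule K_sub(4)[OF C(1)])
    have odd_factor: "\<exists>H. parity_factor E (b(u := b u - 1)) C H" if C: "C \<in> ?O" and u: "u \<in> C" for C u
    proof (rule less.hyps)
      have CK: "C \<in> ?K" and odd: "odd (sum b C)" using C by (auto simp: odd_comps_def)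
      let ?b = "b(u := b u - 1)"
      show "finite C" by (rule K_sub(4)[OF CK])
      have sum_b': "sum ?b S = sum b S - (if u \<in> S then 1 else 0)" if "S \<subseteq> C" for S
        using finite_subset[OF that \<open>finite C\<close>] by (rule sum_decrement)
      show "nat (sum ?b C) + card C < nat (sum b A) + card A"
        using smaller[OF CK] sum_b'[of C] u by simp
      fix S assume S: "S \<subseteq> C"
      show "int (card (odd_comps E ?b (C - S))) \<le> sum ?b S"
      proof (cases "S = {}")
        case True
        \<comment> \<open>Only \<open>C\<close> itself could be an odd component here, and the lowered bound makes it even.\<close>
        have "even (sum ?b C)" using sum_b'[of C] u odd by simp
        then have "odd_comps E ?b C = {}"
          using comps_component[OF CK] by (auto simp: odd_comps_def)
        with True show ?thesis by simp
      next
        case False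
        have "q (T \<union> S) \<le> sum b (T \<union> S) - 2"
          using S False TA K_sub(1,2)[OF CK] by (intro above) auto
        then have le: "int (card (odd_comps E b (C - S))) \<le> sum b S - 1"
          using q_C[OF CK S] sum_TS[OF CK S] odd qT by simp
        show ?thesis
        proof (cases "u \<in> S")
          case True
          have "odd_comps E ?b (C - S) = odd_comps E b (C - S)"
            using True by (intro odd_comps_cong) auto
          then show ?thesis using le True sum_b'[OF S] by simp
        next
          case False
          \<comment> \<open>The slack of one absorbs the one component that may have become odd.\<close>
          have "card (odd_comps E ?b (C - S)) \<le> card (odd_comps E b (C - S)) + 1"
            using \<open>finite C\<close> by (intro card_odd_comps_change_one[OF sym_E, where u = u]) auto
          then show ?thesis using le False sum_b'[OF S] by simp
        qed
      qed
    qed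
    define N where "N = (\<lambda>C. {t \<in> T. \<exists>u\<in>C. (t, u) \<in> E})"
    have finT: "finite T" using TA fin by (rule finite_subset)
    have sum_nat: "int (\<Sum>t\<in>S. nat (b t)) = sum b S" if "S \<subseteq> T" for S
      using that TA b_nonneg by (auto intro!: sum.cong)
    have "\<exists>f. (\<forall>C\<in>?O. f C \<in> N C) \<and> (\<forall>t. card {C \<in> ?O. f C = t} \<le> nat (b t))"
    proof (rule capacitated_hall)
      show "finite ?O" using finAT by (rule finite_odd_comps)
      show "finite (N C)" for C using finT by (simp add: N_def)
      fix J assume J: "J \<subseteq> ?O"
      let ?S = "\<Union>(N ` J)"
      have S: "?S \<subseteq> T" by (auto simp: N_def)
      have "J \<subseteq> odd_comps E b (A - ?S)"
      proof
        fix C assume "C \<in> J"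
        then have C: "C \<in> ?K" "odd (sum b C)" using J by (auto simp: odd_comps_def)
        have "C \<in> comps E (A - ?S)"
        proof (rule comps_mono_neighbours[OF C(1)])
          show "A - T \<subseteq> A - ?S" using S by blast
          fix x y assume "x \<in> C" "y \<in> A - ?S" "(x, y) \<in> E"
          then show "y \<in> A - T"
            using symD[OF sym_E] \<open>C \<in> J\<close> by (fastforce simp: N_def)
        qed
        with C show "C \<in> odd_comps E b (A - ?S)" by (simp add: odd_comps_def)
      qed
      then have "card J \<le> card (odd_comps E b (A - ?S))"
        using fin by (intro card_mono finite_odd_comps) auto
      then have "int (card J) \<le> q ?S" by (simp add: q_def)
      also have "\<dots> \<le> sum b ?S" using S TA by (intro q_le) auto
      also have "\<dots> = int (\<Sum>t\<in>?S. nat (b t))" using sum_nat[OF S] by simp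
      finally show "card J \<le> (\<Sum>t\<in>?S. nat (b t))" by (simp only: of_nat_le_iff)
    qed
    then obtain f where f: "\<And>C. C \<in> ?O \<Longrightarrow> f C \<in> N C"
      and cap: "\<And>t. card {C \<in> ?O. f C = t} \<le> nat (b t)" by blast
    \<comment> \<open>A vertex of \<open>T\<close> with a free place would make the odd components fewer than \<open>b(T)\<close>.\<close>
    have cap_eq: "card {C \<in> ?O. f C = t} = nat (b t)" if "t \<in> T" for t
    proof (rule ccontr)
      assume "card {C \<in> ?O. f C = t} \<noteq> nat (b t)"
      then have "card {C \<in> ?O. f C = t} < nat (b t)"
        using cap[of t] by linarith
      then have "(\<Sum>t\<in>T. card {C \<in> ?O. f C = t}) < (\<Sum>t\<in>T. nat (b t))"
        using finT that cap by (intro sum_strict_mono_ex1) blast+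
      also have "(\<Sum>t\<in>T. nat (b t)) = card ?O"
        using sum_nat[OF order_refl] qT unfolding q_def by (metis of_nat_eq_iff)
      also have "card ?O = (\<Sum>C\<in>?O. \<Sum>t\<in>T. if f C = t then 1 else 0)"
        using finT f by (simp add: N_def)
      also have "\<dots> = (\<Sum>t\<in>T. card {C \<in> ?O. f C = t})"
        using finite_odd_comps[OF finAT, of E b]
        by (subst sum.swap) (simp add: sum.If_cases Int_def)
      finally show False by simp
    qed
    have "\<exists>u. u \<in> C \<and> (f C, u) \<in> E" if "C \<in> ?O" for C using f[OF that] by (auto simp: N_def)
    then obtain h where h: "\<And>C. C \<in> ?O \<Longrightarrow> h C \<in> C \<and> (f C, h C) \<in> E" by metis
    define F where "F = (\<lambda>C. SOME H. parity_factor E (if C \<in> ?O then b(h C := b (h C) - 1) else b) C H)"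
    show ?thesis
    proof (rule parity_factor_glue[OF sym_E fin TA, of b h f F])
      show "h C \<in> C" "(f C, h C) \<in> E" "f C \<in> T" if "C \<in> ?O" for C
        using h[OF that] f[OF that] by (auto simp: N_def)
      show "int (card {C \<in> ?O. f C = t}) = b t" if "t \<in> T" for t
        using cap_eq[OF that] b_nonneg that TA by auto
      show "parity_factor E (b(h C := b (h C) - 1)) C (F C)" if "C \<in> ?O" for C
        using someI_ex[OF odd_factor[OF that, of "h C"]] h[OF that] that by (simp add: F_def)
      show "parity_factor E b C (F C)" if "C \<in> ?K" "C \<notin> ?O" for C
        using someI_ex[OF even_factor[OF that]] that by (simp add: F_def)
    qed
  qed
qed

section \<open>Parity of degree sums\<close>

lemma even_card_sym_irrefl:
  assumes "finite R" "sym R" "irrefl R"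
  shows "even (card R)"
  using assms
proof (induction "card R" arbitrary: R rule: less_induct)
  case less
  show ?case
  proof (cases "R = {}")
    case False
    then obtain x y where xy: "(x, y) \<in> R" by auto
    then have yx: "(y, x) \<in> R" "(x, y) \<noteq> (y, x)"
      using less.prems by (auto simp: sym_def irrefl_def)
    let ?R = "R - {(x, y), (y, x)}"
    have "card {(x, y), (y, x)} = 2" using yx(2) by simp
    then have card_R: "card R = card ?R + 2"
      using less.prems(1) xy yx(1) card_mono[of R "{(x, y), (y, x)}"]
      by (simp add: card_Diff_subset)
    moreover have "even (card ?R)"
      using less.prems card_R by (intro less.hyps) (auto simp: sym_def irrefl_def)
    ultimately show ?thesis by simp
  qed simp
qed

text \<open>
  The handshaking lemma for a vertex set \<open>C\<close>: the arcs inside \<open>C\<close> come in opposite pairs, so that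
  only the arcs leaving \<open>C\<close> influence the parity of the degree sum.
\<close>

lemma even_degree_sum_plus_cut:
  assumes "finite R" "sym R" "irrefl R" "finite C"
  shows "even ((\<Sum>v\<in>C. card (R `` {v})) + card (R \<inter> C \<times> - C))"
proof -
  have "finite (R `` {v})" for v using assms(1) by (rule finite_Image)
  then have "(\<Sum>v\<in>C. card (R `` {v})) = card (SIGMA v:C. R `` {v})"
    using assms(4) by simp
  also have "(SIGMA v:C. R `` {v}) = R \<inter> C \<times> C \<union> R \<inter> C \<times> - C" by auto
  also have "card \<dots> = card (R \<inter> C \<times> C) + card (R \<inter> C \<times> - C)"
    using assms(1) by (intro card_Un_disjoint) auto
  finally have "(\<Sum>v\<in>C. card (R `` {v})) + card (R \<inter> C \<times> - C) =
      card (R \<inter> C \<times> C) + 2 * card (R \<inter> C \<times> - C)" by simp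
  moreover have "even (card (R \<inter> C \<times> C))"
    using assms by (intro even_card_sym_irrefl) (auto simp: sym_def irrefl_def)
  ultimately show ?thesis by simp
qed

section \<open>The deficiency condition for all parity sets\<close>

definition realises_parity :: "('a \<times> 'a) set \<Rightarrow> 'a set \<Rightarrow> 'a set \<Rightarrow> ('a \<times> 'a) set \<Rightarrow> bool" where
  "realises_parity E V X R \<longleftrightarrow>
     R \<subseteq> E \<and> sym R \<and> (\<forall>v\<in>V. R `` {v} \<noteq> {} \<and> (odd (card (R `` {v})) \<longleftrightarrow> v \<in> X))"

context
  fixes E :: "('a \<times> 'a) set" and V :: "'a set"
  assumes finV: "finite V" and EV: "E \<subseteq> V \<times> V" and sym_E: "sym E" and irrefl_E: "irrefl E"
begin

lemma finE: "finite E"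
  using EV finV by (auto intro: finite_subset)

text \<open>
  Removing from \<open>E\<close> a parity factor \<open>H\<close> for \<open>b = d - 1\<close> on \<open>X\<close> and \<open>b = d - 2\<close> elsewhere
  leaves every vertex at least the degree 1 or 2, of the right parity. The condition bounds the number
  of all components, whereas the factor theorem counts only those with odd \<open>b\<close>; it falls short
  by one of what that theorem needs, and the parity of \<open>b(S)\<close> minus the number of odd components
  makes up for it.
\<close>

lemma realises_parity_if_deficiency:
  assumes cond: "\<And>T. T \<subseteq> V \<Longrightarrow>
      (\<Sum>x\<in>T. int (card (E `` {x}))) - 2 * int (card T) - int (card (comps E (V - T))) \<ge> - 1"
    and X: "X \<subseteq> V" "even (card X)"
  shows "\<exists>R. realises_parity E V X R"
proof -
  define d where "d = (\<lambda>v. int (card (E `` {v})))"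
  define b where "b = (\<lambda>v. d v - (if v \<in> X then 1 else 2))"
  have sum_b: "sum b S = (\<Sum>x\<in>S. d x) - 2 * int (card S) + int (card (S \<inter> X))"
    if "S \<subseteq> V" for S
  proof -
    have finS: "finite S" using that finV by (rule finite_subset)
    have "sum b S = (\<Sum>x\<in>S. d x - 2 + (if x \<in> X then 1 else 0))"
      by (intro sum.cong) (auto simp: b_def)
    also have "\<dots> = (\<Sum>x\<in>S. d x) - 2 * int (card S) + (\<Sum>x\<in>S. if x \<in> X then 1 else 0)"
      by (simp add: sum.distrib sum_subtractf)
    also have "(\<Sum>x\<in>S. if x \<in> X then 1 else 0) = int (card (S \<inter> X))"
      using finS by (simp add: sum.If_cases Int_def)
    finally show ?thesis .
  qed
  have even_V: "even (sum b V)"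
  proof -
    have "E \<inter> V \<times> - V = {}" using EV by auto
    then have "even (\<Sum>v\<in>V. card (E `` {v}))"
      using even_degree_sum_plus_cut[OF finE sym_E irrefl_E finV] by simp
    then have "even (\<Sum>v\<in>V. d v)" by (simp add: d_def flip: of_nat_sum)
    moreover have "V \<inter> X = X" using X(1) by blast
    ultimately show ?thesis using sum_b[of V] X(2) by simp
  qed
  have "int (card (odd_comps E b (V - S))) \<le> sum b S" if S: "S \<subseteq> V" for S
  proof -
    let ?q = "int (card (odd_comps E b (V - S)))"
    have "card (odd_comps E b (V - S)) \<le> card (comps E (V - S))"
      using finV by (intro card_mono finite_comps) (auto simp: odd_comps_def)
    then have "?q \<le> sum b S + 1"
      using cond[OF S] sum_b[OF S] by (simp add: d_def)
    moreover have "even (sum b S - ?q)"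
    proof -
      have "sum b V = sum b (V - S) + sum b S" using S finV by (rule sum.subset_diff)
      then have "sum b S - ?q = sum b V - (sum b (V - S) - ?q) - 2 * ?q" by simp
      then show ?thesis
        using even_V even_sum_minus_odd_comps[OF sym_E, of "V - S" b] finV by simp
    qed
    ultimately show ?thesis by presburger
  qed
  then obtain H where H: "parity_factor E b V H"
    using parity_factor_exists[OF sym_E finV] by blast
  have R_ok: "(E - H) `` {v} \<noteq> {} \<and> (odd (card ((E - H) `` {v})) \<longleftrightarrow> v \<in> X)" if "v \<in> V" for v
  proof -
    have sub: "H `` {v} \<subseteq> E `` {v}" and fin: "finite (E `` {v})"
      using H finE by (auto simp: parity_factor_def intro: finite_Image)
    have "(E - H) `` {v} = E `` {v} - H `` {v}" by auto
    then have "card ((E - H) `` {v}) = card (E `` {v}) - card (H `` {v})"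
      using card_Diff_subset[OF finite_subset[OF sub fin] sub] by simp
    then have card_R: "int (card ((E - H) `` {v})) = d v - int (card (H `` {v}))"
      using card_mono[OF fin sub] by (simp add: d_def)
    have h: "int (card (H `` {v})) \<le> b v" "even (b v - int (card (H `` {v})))"
      using H that by (auto simp: parity_factor_def)
    have "int (card ((E - H) `` {v})) > 0" using card_R h(1) by (simp add: b_def split: if_splits)
    then have "(E - H) `` {v} \<noteq> {}" by auto
    moreover have "even (int (card ((E - H) `` {v})) - (d v - b v))" using card_R h(2) by simp
    then have "odd (card ((E - H) `` {v})) \<longleftrightarrow> v \<in> X" by (simp add: b_def split: if_splits)
    ultimately show ?thesis by blast
  qed
  have "sym (E - H)" using H sym_E by (auto simp: parity_factor_def sym_def)
  with R_ok have "realises_parity E V X (E - H)" by (simp add: realises_parity_def)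
  then show ?thesis by blast
qed

text \<open>
  Choose \<open>X\<close> disjoint from \<open>T\<close> so that for every component \<open>C\<close> of \<open>V - T\<close>, with at most one
  exception, the parities required on \<open>C\<close> cannot be met by using all edges between \<open>C\<close> and
  \<open>T\<close>. Then \<open>R\<close> omits an edge from \<open>T\<close> to each such component. On the other hand, each
  vertex of \<open>T\<close> has an even positive degree in \<open>R\<close>, so that at most \<open>d - 2\<close> of its edges are
  omitted.
\<close>

lemma deficiency_if_realises_parity:
  assumes all_X: "\<And>X. X \<subseteq> V \<Longrightarrow> even (card X) \<Longrightarrow> \<exists>R. realises_parity E V X R"
    and T: "T \<subseteq> V"
  shows "(\<Sum>x\<in>T. int (card (E `` {x}))) - 2 * int (card T) - int (card (comps E (V - T))) \<ge> - 1"
proof -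
  let ?K = "comps E (V - T)"
  have finK: "finite ?K" using finV by (simp add: finite_comps)
  have finT: "finite T" using T finV by (rule finite_subset)
  have K_sub: "C \<subseteq> V" "C \<inter> T = {}" "finite C" if "C \<in> ?K" for C
    using compsD(1)[OF that] finite_subset[OF _ finV, of C] by auto
  have K_eq: "C = D" if "C \<in> ?K" "D \<in> ?K" "v \<in> C" "v \<in> D" for C D v
    using comps_eqI that by metis
  have "\<exists>r. \<forall>C\<in>?K. r C \<in> C" using compsD(2) by (metis ex_in_conv)
  then obtain r where r: "\<And>C. C \<in> ?K \<Longrightarrow> r C \<in> C" by blast
  have inj_r: "inj_on r ?K" using K_eq r by (intro inj_onI) metis
  \<comment> \<open>The components in which a vertex should be put into \<open>X\<close>: their full boundary is even.\<close>
  define B0 where "B0 = {C \<in> ?K. even (card (E \<inter> C \<times> - C))}"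
  \<comment> \<open>Since \<open>X\<close> must be even, one of these components may have to be given up; it accounts for
    the deficiency of one in the conclusion.\<close>
  have "\<exists>B\<subseteq>B0. even (card B) \<and> card (B0 - B) \<le> 1"
  proof (cases "even (card B0)")
    case False
    then have "B0 \<noteq> {}" by auto
    then obtain C where C: "C \<in> B0" by blast
    have finB0: "finite B0" using finK by (simp add: B0_def)
    then have "card B0 = Suc (card (B0 - {C}))" using C by (metis card.remove)
    moreover have "B0 - (B0 - {C}) = {C}" using C by blast
    ultimately show ?thesis using False by (intro exI[of _ "B0 - {C}"]) auto
  qed (intro exI[of _ B0], simp)
  then obtain B where B: "B \<subseteq> B0" "even (card B)" "card (B0 - B) \<le> 1" by blast
  have BK: "B \<subseteq> ?K" using B(1) by (auto simp: B0_def)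
  define X where "X = r ` B"
  have X_C: "X \<inter> C = (if C \<in> B then {r C} else {})" if "C \<in> ?K" for C
  proof -
    have "D = C" if "D \<in> B" "r D \<in> C" for D
      using K_eq[OF _ \<open>C \<in> ?K\<close> r that(2)] that(1) BK by blast
    then show ?thesis using r[OF that] by (auto simp: X_def)
  qed
  have XV: "X \<subseteq> V" using r K_sub(1) BK by (auto simp: X_def)
  have XT: "X \<inter> T = {}" using r K_sub(2) BK by (fastforce simp: X_def)
  have "card X = card B" unfolding X_def using inj_on_subset[OF inj_r BK] by (rule card_image)
  then obtain R where R: "realises_parity E V X R" using all_X[OF XV] B(2) by auto
  have RE: "R \<subseteq> E" "sym R" using R by (auto simp: realises_parity_def)
  have finR: "finite R" using RE(1) finE by (rule finite_subset)
  have irrefl_R: "irrefl R" using RE(1) irrefl_E by (auto simp: irrefl_def)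
  let ?Good = "?K - (B0 - B)"
  have "\<exists>e. e \<in> E - R \<and> fst e \<in> T \<and> snd e \<in> C" if C: "C \<in> ?Good" for C
  proof -
    have CK: "C \<in> ?K" using C by blast
    have "odd (\<Sum>v\<in>C. card (R `` {v})) \<longleftrightarrow> odd (card {v \<in> C. odd (card (R `` {v}))})"
      using K_sub(3)[OF CK] by (simp add: even_sum_iff)
    also have "{v \<in> C. odd (card (R `` {v}))} = X \<inter> C"
      using R K_sub(1)[OF CK] by (auto simp: realises_parity_def)
    also have "odd (card (X \<inter> C)) \<longleftrightarrow> C \<in> B" using X_C[OF CK] by simp
    also have "C \<in> B \<longleftrightarrow> even (card (E \<inter> C \<times> - C))" using C B(1) by (auto simp: B0_def)
    finally have "card (R \<inter> C \<times> - C) \<noteq> card (E \<inter> C \<times> - C)"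
      using even_degree_sum_plus_cut[OF finR RE(2) irrefl_R K_sub(3)[OF CK]] by auto
    then have "R \<inter> C \<times> - C \<noteq> E \<inter> C \<times> - C" by metis
    then obtain u w where uw: "(u, w) \<in> E" "(u, w) \<notin> R" "u \<in> C" "w \<notin> C"
      using RE(1) by blast
    moreover have "w \<in> T" using compsD(3)[OF CK uw(3) _ uw(1)] uw(1,4) EV by auto
    ultimately show ?thesis
      using symD[OF sym_E uw(1)] symD[OF RE(2), of w u] by (intro exI[of _ "(w, u)"]) auto
  qed
  then obtain e where e: "\<And>C. C \<in> ?Good \<Longrightarrow> e C \<in> E - R \<and> fst (e C) \<in> T \<and> snd (e C) \<in> C"
    by metis
  have "inj_on e ?Good"
  proof (rule inj_onI)
    fix C D assume *: "C \<in> ?Good" "D \<in> ?Good" "e C = e D"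
    then show "C = D" using K_eq[of C D "snd (e C)"] e[OF *(1)] e[OF *(2)] by simp
  qed
  then have "card ?Good = card (e ` ?Good)" by (simp add: card_image)
  also have "\<dots> \<le> card (SIGMA t:T. (E - R) `` {t})"
  proof (rule card_mono)
    show "finite (SIGMA t:T. (E - R) `` {t})"
      using finT finE by (intro finite_SigmaI finite_Image finite_Diff)
    show "e ` ?Good \<subseteq> (SIGMA t:T. (E - R) `` {t})"
    proof
      fix p assume "p \<in> e ` ?Good"
      then obtain C where "C \<in> ?Good" "p = e C" by (rule imageE)
      then show "p \<in> (SIGMA t:T. (E - R) `` {t})"
        using e[of C] by (cases "e C") simp
    qed
  qed
  also have "\<dots> = (\<Sum>t\<in>T. card ((E - R) `` {t}))"
    using finT finE by (simp add: finite_Image)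
  finally have "int (card ?Good) \<le> (\<Sum>t\<in>T. int (card ((E - R) `` {t})))"
    by (simp flip: of_nat_sum)
  also have "\<dots> \<le> (\<Sum>t\<in>T. int (card (E `` {t})) - 2)"
  proof (rule sum_mono)
    fix t assume t: "t \<in> T"
    have sub: "R `` {t} \<subseteq> E `` {t}" and fin: "finite (E `` {t})"
      using RE(1) finE by (auto intro: finite_Image)
    have "t \<in> V" "t \<notin> X" using t T XT by auto
    then have "R `` {t} \<noteq> {}" "even (card (R `` {t}))"
      using R by (auto simp: realises_parity_def)
    moreover have "finite (R `` {t})" using sub fin by (rule finite_subset)
    ultimately have "card (R `` {t}) \<noteq> 0" by simp
    with \<open>even (card (R `` {t}))\<close> have "2 \<le> card (R `` {t})" by presburger
    moreover have "(E - R) `` {t} = E `` {t} - R `` {t}" by auto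
    then have "card ((E - R) `` {t}) = card (E `` {t}) - card (R `` {t})"
      using card_Diff_subset[OF finite_subset[OF sub fin] sub] by simp
    ultimately show "int (card ((E - R) `` {t})) \<le> int (card (E `` {t})) - 2"
      using card_mono[OF fin sub] by simp
  qed
  also have "\<dots> = (\<Sum>t\<in>T. int (card (E `` {t}))) - 2 * int (card T)"
    by (simp add: sum_subtractf)
  finally have "int (card ?Good) \<le> (\<Sum>t\<in>T. int (card (E `` {t}))) - 2 * int (card T)" .
  moreover have "card ?K \<le> card ?Good + 1"
  proof -
    have "card ?K \<le> card (?Good \<union> (B0 - B))"
      using finK by (intro card_mono) (auto simp: B0_def)
    also have "\<dots> \<le> card ?Good + card (B0 - B)" by (rule card_Un_le)
    finally have "card ?K \<le> card ?Good + card (B0 - B)" .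
    then show ?thesis using B(3) by simp
  qed
  ultimately show ?thesis by simp
qed

end

section \<open>Translation to symmetric digraphs\<close>

lemma (in nomulti_digraph) out_degree_eq_card_Image:
  "out_degree G v = card (arcs_ends G `` {v})"
proof -
  have "inj_on (head G) (out_arcs G v)"
    using no_multi_arcs by (intro inj_onI) (auto simp: arc_to_ends_def)
  moreover have "head G ` out_arcs G v = arcs_ends G `` {v}"
    by (auto simp: arcs_ends_conv image_iff)
  ultimately show ?thesis by (metis card_image out_degree_def)
qed

text \<open>
  In a symmetric digraph reachability is an equivalence relation whose classes are both the strongly
  connected components and the minimal closed sets.
\<close>

lemma (in graph) sccs_verts_eq_comps: "sccs_verts = comps (arcs_ends G) (verts G)"
proof -
  have scc: "S \<in> comps (arcs_ends G) (verts G)" if S: "S \<in> sccs_verts" for S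
  proof -
    have reach: "\<And>u v. u \<in> S \<Longrightarrow> v \<in> S \<Longrightarrow> u \<rightarrow>\<^sup>* v" and ne: "S \<noteq> {}"
      and sep: "\<And>u v. u \<in> S \<Longrightarrow> u \<rightarrow>\<^sup>* v \<Longrightarrow> v \<in> S"
      using S symmetric_reachable' unfolding in_sccs_verts_conv_reachable by blast+
    have closed: "closed_in (arcs_ends G) (verts G) S"
      using sccs_verts_subsets[OF S] sep by (auto simp: closed_in_def)
    moreover have "D = S" if D: "D \<noteq> {}" "closed_in (arcs_ends G) S D" for D
    proof
      show "D \<subseteq> S" using D(2) by (simp add: closed_in_def)
      obtain d where d: "d \<in> D" using D(1) by blast
      show "S \<subseteq> D"
      proof
        fix s assume "s \<in> S"
        have "d \<rightarrow>\<^sup>* s" using reach d \<open>D \<subseteq> S\<close> \<open>s \<in> S\<close> by blast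
        then show "s \<in> D"
        proof (induction rule: reachable_induct)
          case (step x y)
          then have "y \<in> S" using sep[of x y] \<open>D \<subseteq> S\<close> by blast
          with step D(2) show ?case by (auto simp: closed_in_def)
        qed (rule d)
      qed
    qed
    ultimately show ?thesis using ne by (simp add: comps_def)
  qed
  have "C \<in> sccs_verts" if C: "C \<in> comps (arcs_ends G) (verts G)" for C
  proof -
    obtain u where u: "u \<in> C" "u \<in> verts G" using compsD(1,2)[OF C] by blast
    then have "scc_of u \<in> sccs_verts" "u \<in> scc_of u"
      by (auto intro: scc_of_in_sccs_verts in_scc_of_self)
    then show ?thesis using comps_eqI[OF C scc] u(1) by metis
  qed
  with scc show ?thesis by blast
qed

lemma (in graph) graph_subset_arcs:
  assumes "A \<subseteq> arcs G" "symmetric (G\<lparr>arcs := A\<rparr>)"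
  shows "graph (G\<lparr>arcs := A\<rparr>)"
proof -
  have "finite A" using assms(1) finite_arcs by (rule finite_subset)
  moreover have "e1 = e2" if "e1 \<in> A" "e2 \<in> A" "tail G e1 = tail G e2" "head G e1 = head G e2" for e1 e2
    using that assms(1) no_multi_arcs[of e1 e2] by (auto simp: arc_to_ends_def)
  moreover have "tail G e \<in> verts G" "head G e \<in> verts G" "tail G e \<noteq> head G e" if "e \<in> A" for e
    using that assms(1) no_loops[of e] by auto
  ultimately show ?thesis
    using assms(2) by unfold_locales (simp_all add: arc_to_ends_def)
qed

lemma (in graph) num_components_delete_vertices:
  "num_components (delete_vertices G T) = card (comps (arcs_ends G) (verts G - T))"
proof -
  let ?S = "verts G - T"
  have ends: "arcs_ends (G \<restriction> ?S) = arcs_ends G \<inter> ?S \<times> ?S"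
    by (auto simp: arcs_ends_conv)
  interpret H: graph "G \<restriction> ?S"
  proof (unfold_locales, goal_cases)
    case (6 e1 e2)
    then show ?case using no_multi_arcs[of e1 e2] by (simp add: arc_to_ends_def)
  next
    case 7
    then show ?case using sym_arcs by (auto simp: symmetric_def ends sym_def)
  qed (use no_loops in auto)
  have "num_components (delete_vertices G T) = card H.sccs"
    using components_of_eq_sccs[OF H.sym_digraph_axioms]
    by (simp add: num_components_def delete_vertices_def)
  also have "\<dots> = card H.sccs_verts" by (rule H.card_sccs_verts[symmetric])
  also have "H.sccs_verts = comps (arcs_ends G) ?S"
    by (simp add: H.sccs_verts_eq_comps ends comps_restrict)
  finally show ?thesis .
qed

lemma (in graph) strong_parity_property_iff_realises_parity:
  "strong_parity_property G \<longleftrightarrow>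
    (\<forall>X. X \<subseteq> verts G \<and> even (card X) \<longrightarrow> (\<exists>R. realises_parity (arcs_ends G) (verts G) X R))"
proof -
  have "(\<exists>F. graph F \<and> spanning F G \<and> (\<forall>v\<in>verts F. vertex_degree F v \<ge> 1) \<and>
          (\<forall>v\<in>X. odd (vertex_degree F v)) \<and> (\<forall>y\<in>verts G - X. even (vertex_degree F y)))
      \<longleftrightarrow> (\<exists>R. realises_parity (arcs_ends G) (verts G) X R)" (is "?L \<longleftrightarrow> ?R")
    if X: "X \<subseteq> verts G" for X
  proof
    assume ?L
    then obtain F where F: "graph F" "spanning F G" "\<forall>v\<in>verts F. vertex_degree F v \<ge> 1"
        "\<forall>v\<in>X. odd (vertex_degree F v)" "\<forall>y\<in>verts G - X. even (vertex_degree F y)" by blast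
    interpret F: graph F by (rule F(1))
    have sub: "subgraph F G" "verts F = verts G" using F(2) by (auto simp: spanning_def)
    have "arcs_ends F \<subseteq> arcs_ends G" using sub(1) by (rule arcs_ends_mono)
    moreover have "sym (arcs_ends F)" using F.sym_arcs by (simp add: symmetric_def)
    moreover have "arcs_ends F `` {v} \<noteq> {} \<and> (odd (card (arcs_ends F `` {v})) \<longleftrightarrow> v \<in> X)"
      if "v \<in> verts G" for v
    proof -
      have "card (arcs_ends F `` {v}) \<ge> 1" using F(3) sub(2) that F.out_degree_eq_card_Image by metis
      then have "arcs_ends F `` {v} \<noteq> {}" by auto
      then show ?thesis using F(4,5) that by (auto simp: F.out_degree_eq_card_Image)
    qed
    ultimately show ?R unfolding realises_parity_def by blast
  next
    assume ?R
    then obtain R where R: "realises_parity (arcs_ends G) (verts G) X R" by blast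
    then have RE: "R \<subseteq> arcs_ends G" "sym R" by (auto simp: realises_parity_def)
    define F where "F = G\<lparr>arcs := {a \<in> arcs G. arc_to_ends G a \<in> R}\<rparr>"
    have ends_F: "arcs_ends F = R"
      using RE(1) by (auto simp: F_def arcs_ends_def arc_to_ends_def)
    have gF: "graph F"
      using RE(2) ends_F unfolding F_def by (intro graph_subset_arcs) (auto simp: symmetric_def)
    interpret F: graph F by (rule gF)
    have verts_F: "verts F = verts G" by (simp add: F_def)
    have "spanning F G"
      using F.wf_digraph wf_digraph
      by (auto simp: spanning_def subgraph_def compatible_def F_def)
    moreover have "finite (R `` {v})" for v
      using ends_F F.finite_arcs by (metis arcs_ends_def finite_Image finite_imageI)
    then have "vertex_degree F v \<ge> 1" if "v \<in> verts F" for v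
      using R that by (auto simp: F.out_degree_eq_card_Image ends_F realises_parity_def verts_F
        Suc_le_eq card_gt_0_iff)
    moreover have "\<forall>v\<in>X. odd (vertex_degree F v)" "\<forall>y\<in>verts G - X. even (vertex_degree F y)"
      using R X by (auto simp: F.out_degree_eq_card_Image ends_F realises_parity_def)
    ultimately show ?L using gF by blast
  qed
  then show ?thesis unfolding strong_parity_property_def by blast
qed

theorem theorem2:
  fixes G :: "('a,'b) pre_digraph"
  assumes "graph G"
  shows "strong_parity_property G \<longleftrightarrow>
    (\<forall>T. T \<subseteq> verts G \<longrightarrow>
      (\<Sum>x\<in>T. int (vertex_degree G x)) - 2 * int (card T)
        - int (num_components (delete_vertices G T)) \<ge> - 1)"
proof -
  interpret graph G by (rule assms)
  have E: "finite (verts G)" "arcs_ends G \<subseteq> verts G \<times> verts G"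
    "sym (arcs_ends G)" "irrefl (arcs_ends G)"
    using sym_arcs adj_in_verts adj_not_same by (auto simp: symmetric_def irrefl_def)
  show ?thesis
    unfolding strong_parity_property_iff_realises_parity num_components_delete_vertices
      out_degree_eq_card_Image
  proof (intro iffI allI impI)
    fix T
    assume "\<forall>X. X \<subseteq> verts G \<and> even (card X) \<longrightarrow>
        (\<exists>R. realises_parity (arcs_ends G) (verts G) X R)" and "T \<subseteq> verts G"
    then show "(\<Sum>x\<in>T. int (card (arcs_ends G `` {x}))) - 2 * int (card T)
        - int (card (comps (arcs_ends G) (verts G - T))) \<ge> - 1"
      by (intro deficiency_if_realises_parity[OF E]) simp_all
  next
    fix X
    assume "\<forall>T. T \<subseteq> verts G \<longrightarrow> (\<Sum>x\<in>T. int (card (arcs_ends G `` {x}))) - 2 * int (card T)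
        - int (card (comps (arcs_ends G) (verts G - T))) \<ge> - 1"
      and "X \<subseteq> verts G \<and> even (card X)"
    then show "\<exists>R. realises_parity (arcs_ends G) (verts G) X R"
      by (intro realises_parity_if_deficiency[OF E]) simp_all
  qed
qed

end
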